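(* Let $K\subseteq\mathbb{R}^{n_1+n_2}$ be a regular cone, let $\mathcal{M}=K\cap(\mathbb{Z}^{n_1}\times\mathbb{R}^{n_2})$, and let $c\in\mathbb{R}^{n_1}$, $d\in\mathbb{R}^{n_2}$, $A\in\mathbb{R}^{m\times n_1}$, $G\in\mathbb{R}^{m\times n_2}$, $b\in\mathbb{R}^m$. Consider the conic mixed-integer program $$z^*=\inf\{c^Tx+d^Ty : Ax+Gy=b,\ (x,y)\in\mathcal{M}\}$$ and assume that it is feasible. Consider its subadditive dual over functions on $\mathbb{R}^m$, $$\rho^*=\sup\{f(b) : f(Au+Gv)\le c^Tu+d^Tv\ \text{for all }(u,v)\in\mathcal{I}(\mathcal{M}),\ f(0)=0,\ f:\mathbb{R}^m\to\mathbb{R}\text{ subadditive}\},$$ where $\mathcal{I}(\mathcal{M})$ is an integral generating set of $\mathcal{M}$. Assume that the conic dual of the continuous relaxation of the primal problem is feasible. Then there exists a function $f$ feasible for the subadditive dual such that $f(b)=\rho^*=z^*$.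
   Context: A cone $K\subseteq\mathbb{R}^n$ is regular if it is closed, convex, pointed and full-dimensional. Its dual cone is $K_*=\{y\in\mathbb{R}^n: x^Ty\ge 0\text{ for all }x\in K\}$. A function $f:\mathcal{D}\to\mathbb{R}$ is subadditive if $f(u+v)\le f(u)+f(v)$ for all $u,v\in\mathcal{D}$ with $u+v\in\mathcal{D}$. An integral generating set of a monoid $\mathcal{M}$ (under $+$) is a set $\mathcal{I}(\mathcal{M})\subseteq\mathcal{M}$ such that every $w\in\mathcal{M}$ can be written as $w=\sum_{i=1}^p\lambda_ih_i$ with $h_1,\dots,h_p\in\mathcal{I}(\mathcal{M})$ and $\lambda_1,\dots,\lambda_p\in\mathbb{Z}_+$. The continuous relaxation of the primal problem is $\inf\{c^Tx+d^Ty: Ax+Gy=b,\ (x,y)\in K\}$. Its conic dual is $\sup\{b^T\alpha : \alpha\in\mathbb{R}^m,\ (c-A^T\alpha,\ d-G^T\alpha)\in K_*\}$. *)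

theory Defs
  imports
    "HOL-Analysis.Abstract_Euclidean_Space"
    "HOL-Library.Extended_Real"
    "Jordan_Normal_Form.Matrix"
begin

unbundle no inner_syntax

(* Vectors are taken with an explicit dimension (carrier_vec n), so that n1 = 0 and n2 = 0
   (the purely continuous and purely integer cases) are not excluded, as they would be by a
   type-indexed real ^ 'n.  Euclidean_space n is the usual topology of R^n, on the functions
   nat => real that vanish from index n on; vec_coords identifies carrier_vec n with it. *)

definition vec_coords :: "real vec \<Rightarrow> nat \<Rightarrow> real" where
  "vec_coords x = (\<lambda>i. if i < dim_vec x then x $ i else 0)"

definition regular_cone :: "nat \<Rightarrow> real vec set \<Rightarrow> bool" where
  "regular_cone n K \<longleftrightarrow>
     K \<subseteq> carrier_vec n \<and>
     (\<forall>x\<in>K. \<forall>t\<ge>0. t \<cdot>\<^sub>v x \<in> K) \<and>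
     closedin (Euclidean_space n) (vec_coords ` K) \<and>
     (\<forall>x\<in>K. \<forall>y\<in>K. \<forall>t. 0 \<le> t \<and> t \<le> 1 \<longrightarrow> (1 - t) \<cdot>\<^sub>v x + t \<cdot>\<^sub>v y \<in> K) \<and>
     (\<forall>x\<in>K. - x \<in> K \<longrightarrow> x = 0\<^sub>v n) \<and>
     Euclidean_space n interior_of (vec_coords ` K) \<noteq> {}"

definition dual_cone :: "nat \<Rightarrow> real vec set \<Rightarrow> real vec set" where
  "dual_cone n K = {y \<in> carrier_vec n. \<forall>x\<in>K. x \<bullet> y \<ge> 0}"

definition mixed_integer_points :: "nat \<Rightarrow> nat \<Rightarrow> real vec set \<Rightarrow> real vec set" where
  "mixed_integer_points n1 n2 K =
     K \<inter> {x @\<^sub>v y | x y. x \<in> carrier_vec n1 \<and> (\<forall>i<n1. x $ i \<in> \<int>) \<and> y \<in> carrier_vec n2}"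

definition integral_generating_set :: "nat \<Rightarrow> real vec set \<Rightarrow> real vec set \<Rightarrow> bool" where
  "integral_generating_set n M H \<longleftrightarrow>
     H \<subseteq> M \<and>
     (\<forall>w\<in>M. \<exists>(p::nat) (l :: nat \<Rightarrow> nat) h. (\<forall>i<p. h i \<in> H) \<and>
        w = finsum_vec TYPE(real) n (\<lambda>i. real (l i) \<cdot>\<^sub>v h i) {..<p})"

definition subadditive_on :: "real vec set \<Rightarrow> (real vec \<Rightarrow> real) \<Rightarrow> bool" where
  "subadditive_on D f \<longleftrightarrow> (\<forall>u\<in>D. \<forall>v\<in>D. u + v \<in> D \<longrightarrow> f (u + v) \<le> f u + f v)"

(* Below, A is an m x n1 and G an m x n2 matrix, so m = dim_row A, n1 = dim_col A, n2 = dim_col G. *)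

definition primal_feasible ::
  "real mat \<Rightarrow> real mat \<Rightarrow> real vec \<Rightarrow> real vec set \<Rightarrow> (real vec \<times> real vec) set" where
  "primal_feasible A G b M =
     {(x, y). x \<in> carrier_vec (dim_col A) \<and> y \<in> carrier_vec (dim_col G) \<and>
        A *\<^sub>v x + G *\<^sub>v y = b \<and> x @\<^sub>v y \<in> M}"

(* Optimal values are extended reals, so that unbounded and infeasible problems get their
   customary values. *)

definition primal_value ::
  "real vec \<Rightarrow> real vec \<Rightarrow> real mat \<Rightarrow> real mat \<Rightarrow> real vec \<Rightarrow> real vec set \<Rightarrow> ereal" where
  "primal_value c d A G b M =
     (INF (x, y)\<in>primal_feasible A G b M. ereal (c \<bullet> x + d \<bullet> y))"

(* A function R^m -> R is represented by its values on carrier_vec m. *)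

definition subadditive_dual_feasible ::
  "real vec \<Rightarrow> real vec \<Rightarrow> real mat \<Rightarrow> real mat \<Rightarrow> real vec set \<Rightarrow> (real vec \<Rightarrow> real) set" where
  "subadditive_dual_feasible c d A G H =
     {f. (\<forall>u\<in>carrier_vec (dim_col A). \<forall>v\<in>carrier_vec (dim_col G).
            u @\<^sub>v v \<in> H \<longrightarrow> f (A *\<^sub>v u + G *\<^sub>v v) \<le> c \<bullet> u + d \<bullet> v) \<and>
         f (0\<^sub>v (dim_row A)) = 0 \<and>
         subadditive_on (carrier_vec (dim_row A)) f}"

definition subadditive_dual_value ::
  "real vec \<Rightarrow> real vec \<Rightarrow> real mat \<Rightarrow> real mat \<Rightarrow> real vec \<Rightarrow> real vec set \<Rightarrow> ereal" where
  "subadditive_dual_value c d A G b H =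
     (SUP f\<in>subadditive_dual_feasible c d A G H. ereal (f b))"

definition conic_dual_feasible ::
  "real vec \<Rightarrow> real vec \<Rightarrow> real mat \<Rightarrow> real mat \<Rightarrow> real vec set \<Rightarrow> real vec set" where
  "conic_dual_feasible c d A G K =
     {\<alpha> \<in> carrier_vec (dim_row A).
        (c - transpose_mat A *\<^sub>v \<alpha>) @\<^sub>v (d - transpose_mat G *\<^sub>v \<alpha>)
          \<in> dual_cone (dim_col A + dim_col G) K}"

end

theory Submission
  imports Defs
begin

text \<open>
  The value function of the primal problem is subadditive in the right-hand side, but infinite at
  infeasible right-hand sides. A feasible point \<open>\<alpha>\<close> of the conic dual bounds it below by the linear
  function \<open>u \<mapsto> \<alpha> \<bullet> u\<close>. Hence the minimum of the value function and \<open>u \<mapsto> \<alpha> \<bullet> u + C\<close> is finite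
  everywhere and, for every \<open>C \<ge> 0\<close>, still subadditive: the excess over \<open>\<alpha> \<bullet> u\<close> is nonnegative and
  subadditive, and capping it at \<open>C\<close> preserves this. The choice \<open>C = z\<^sup>* - \<alpha> \<bullet> b\<close> keeps the value
  \<open>z\<^sup>*\<close> at \<open>b\<close>.
\<close>

section \<open>Finite combinations with natural coefficients\<close>

lemma finsum_vec_lessThan_Suc:
  assumes "\<And>i. i < Suc p \<Longrightarrow> g i \<in> carrier_vec n"
  shows "finsum_vec TYPE(real) n g {..<Suc p} = g p + finsum_vec TYPE(real) n g {..<p}"
  using assms by (simp add: lessThan_Suc finsum_vec_insert)

text \<open>Induction principle for integral generating sets: scaling by a natural number is
  repeated addition, so a property stable under addition passes from the generators to everything
  they generate. \<open>P0\<close> covers both a zero coefficient and the empty combination.\<close>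

lemma nat_combination_closed:
  fixes P :: "real vec \<Rightarrow> bool"
  assumes P0: "P (0\<^sub>v n)"
    and Padd: "\<And>v w. v \<in> carrier_vec n \<Longrightarrow> w \<in> carrier_vec n \<Longrightarrow> P v \<Longrightarrow> P w \<Longrightarrow> P (v + w)"
    and h: "\<And>i. i < (p::nat) \<Longrightarrow> h i \<in> carrier_vec n" "\<And>i. i < p \<Longrightarrow> P (h i)"
  shows "P (finsum_vec TYPE(real) n (\<lambda>i. real (l i) \<cdot>\<^sub>v h i) {..<p})"
proof -
  have mult: "P (real k \<cdot>\<^sub>v v)" if "v \<in> carrier_vec n" "P v" for k v
  proof (induction k)
    case 0
    have "real 0 \<cdot>\<^sub>v v = 0\<^sub>v n" using that(1) by (intro eq_vecI) auto
    then show ?case using P0 by simp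
  next
    case (Suc k)
    have "real (Suc k) \<cdot>\<^sub>v v = v + real k \<cdot>\<^sub>v v"
      using that(1) by (intro eq_vecI) (auto simp: algebra_simps)
    then show ?case using Padd[of v "real k \<cdot>\<^sub>v v"] that Suc by simp
  qed
  show ?thesis using h
  proof (induction p)
    case 0
    then show ?case using P0 by (simp add: finsum_vec_empty)
  next
    case (Suc p)
    then have "P (real (l p) \<cdot>\<^sub>v h p + finsum_vec TYPE(real) n (\<lambda>i. real (l i) \<cdot>\<^sub>v h i) {..<p})"
      by (intro Padd mult finsum_vec_closed) auto
    then show ?case using Suc.prems by (subst finsum_vec_lessThan_Suc) auto
  qed
qed

section \<open>The monoid structure of the mixed-integer points\<close>

lemma mixed_integer_points_zero:
  assumes "regular_cone (n1 + n2) K" "K \<noteq> {}"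
  shows "0\<^sub>v n1 @\<^sub>v 0\<^sub>v n2 \<in> mixed_integer_points n1 n2 K"
proof -
  obtain w where w: "w \<in> K" using assms(2) by blast
  \<comment> \<open>The origin is obtained by scaling an arbitrary member of the cone by
    \<open>0\<close>.\<close>
  then have "w \<in> carrier_vec (n1 + n2)" and "0 \<cdot>\<^sub>v w \<in> K"
    using assms(1) unfolding regular_cone_def by auto
  moreover from this have "0 \<cdot>\<^sub>v w = 0\<^sub>v n1 @\<^sub>v 0\<^sub>v n2" by (intro eq_vecI) auto
  ultimately show ?thesis unfolding mixed_integer_points_def by fastforce
qed

text \<open>A convex cone is closed under addition because \<open>v + w\<close> is twice the
  midpoint of \<open>v\<close> and \<open>w\<close>; integrality of the first block is checked
  separately.\<close>

lemma mixed_integer_points_add: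
  assumes K: "regular_cone (n1 + n2) K"
    and "v \<in> mixed_integer_points n1 n2 K" "w \<in> mixed_integer_points n1 n2 K"
  shows "v + w \<in> mixed_integer_points n1 n2 K"
proof -
  have carr: "K \<subseteq> carrier_vec (n1 + n2)"
    and scale: "\<And>x t. x \<in> K \<Longrightarrow> 0 \<le> t \<Longrightarrow> t \<cdot>\<^sub>v x \<in> K"
    and conv: "\<And>x y t. x \<in> K \<Longrightarrow> y \<in> K \<Longrightarrow> 0 \<le> t \<Longrightarrow> t \<le> 1 \<Longrightarrow> (1 - t) \<cdot>\<^sub>v x + t \<cdot>\<^sub>v y \<in> K"
    using K unfolding regular_cone_def by blast+
  have vw: "v \<in> K" "w \<in> K" using assms(2,3) unfolding mixed_integer_points_def by auto
  have "2 \<cdot>\<^sub>v ((1 - 1/2) \<cdot>\<^sub>v v + (1/2) \<cdot>\<^sub>v w) \<in> K"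
    using scale[OF conv[OF vw, of "1/2"], of 2] by simp
  moreover have "2 \<cdot>\<^sub>v ((1 - 1/2) \<cdot>\<^sub>v v + (1/2) \<cdot>\<^sub>v w) = v + w"
    using subsetD[OF carr vw(1)] subsetD[OF carr vw(2)] by (intro eq_vecI) (auto simp: algebra_simps)
  ultimately have "v + w \<in> K" by simp
  moreover obtain x y x' y' where
    "x \<in> carrier_vec n1" "\<forall>i<n1. x $ i \<in> \<int>" "y \<in> carrier_vec n2" "v = x @\<^sub>v y"
    "x' \<in> carrier_vec n1" "\<forall>i<n1. x' $ i \<in> \<int>" "y' \<in> carrier_vec n2" "w = x' @\<^sub>v y'"
    using assms(2,3) unfolding mixed_integer_points_def by auto
  moreover from this have "v + w = (x + x') @\<^sub>v (y + y')" by (simp add: append_vec_add)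
  moreover from calculation have "\<forall>i<n1. (x + x') $ i \<in> \<int>" by auto
  ultimately show ?thesis unfolding mixed_integer_points_def by (auto intro!: exI)
qed

section \<open>Additivity of the primal data, and finiteness of the primal value\<close>

lemma mult_mat_vec_zero:
  "B \<in> carrier_mat m n \<Longrightarrow> B *\<^sub>v 0\<^sub>v n = (0\<^sub>v m :: real vec)"
  by (intro eq_vecI) auto

lemma mult_mat_vec_add_swap:
  fixes A G :: "real mat"
  assumes "A \<in> carrier_mat m n1" "G \<in> carrier_mat m n2"
    and "x \<in> carrier_vec n1" "x' \<in> carrier_vec n1" "y \<in> carrier_vec n2" "y' \<in> carrier_vec n2"
  shows "A *\<^sub>v (x + x') + G *\<^sub>v (y + y') = (A *\<^sub>v x + G *\<^sub>v y) + (A *\<^sub>v x' + G *\<^sub>v y')"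
  using assms
  by (simp add: mult_add_distrib_mat_vec[of A m n1] mult_add_distrib_mat_vec[of G m n2])
     (intro eq_vecI, auto)

lemma scalar_prod_add_swap:
  fixes c d :: "real vec"
  assumes "c \<in> carrier_vec n1" "d \<in> carrier_vec n2"
    and "x \<in> carrier_vec n1" "x' \<in> carrier_vec n1" "y \<in> carrier_vec n2" "y' \<in> carrier_vec n2"
  shows "c \<bullet> (x + x') + d \<bullet> (y + y') = (c \<bullet> x + d \<bullet> y) + (c \<bullet> x' + d \<bullet> y')"
  using assms by (simp add: scalar_prod_add_distrib[of c n1] scalar_prod_add_distrib[of d n2])

lemma primal_feasible_add:
  assumes "regular_cone (n1 + n2) K" "A \<in> carrier_mat m n1" "G \<in> carrier_mat m n2"
    and "(x, y) \<in> primal_feasible A G u (mixed_integer_points n1 n2 K)"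
    and "(x', y') \<in> primal_feasible A G v (mixed_integer_points n1 n2 K)"
  shows "(x + x', y + y') \<in> primal_feasible A G (u + v) (mixed_integer_points n1 n2 K)"
  using assms mixed_integer_points_add[OF assms(1), of "x @\<^sub>v y" "x' @\<^sub>v y'"]
  by (auto simp: primal_feasible_def mult_mat_vec_add_swap append_vec_add)

text \<open>The point of \<open>K\<close> pairs nonnegatively with the dual slack vector, and moving
  the transposes across the inner product turns this pairing into the cost minus
  \<open>\<alpha> \<bullet> u\<close>.\<close>

lemma conic_weak_duality:
  assumes "A \<in> carrier_mat m n1" "G \<in> carrier_mat m n2" "c \<in> carrier_vec n1" "d \<in> carrier_vec n2"
    and "\<alpha> \<in> conic_dual_feasible c d A G K"
    and "(x, y) \<in> primal_feasible A G u K"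
  shows "\<alpha> \<bullet> u \<le> c \<bullet> x + d \<bullet> y"
proof -
  have \<alpha>: "\<alpha> \<in> carrier_vec m" and x: "x \<in> carrier_vec n1" and y: "y \<in> carrier_vec n2"
    and u: "u = A *\<^sub>v x + G *\<^sub>v y" and K: "x @\<^sub>v y \<in> K"
    using assms by (auto simp: conic_dual_feasible_def primal_feasible_def)
  have "0 \<le> (x @\<^sub>v y) \<bullet> ((c - transpose_mat A *\<^sub>v \<alpha>) @\<^sub>v (d - transpose_mat G *\<^sub>v \<alpha>))"
    using assms(5) K by (auto simp: conic_dual_feasible_def dual_cone_def)
  also have "\<dots> = x \<bullet> (c - transpose_mat A *\<^sub>v \<alpha>) + y \<bullet> (d - transpose_mat G *\<^sub>v \<alpha>)"
    using assms x y \<alpha> by (intro scalar_prod_append) auto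
  also have "\<dots> = (x \<bullet> c - x \<bullet> (transpose_mat A *\<^sub>v \<alpha>)) + (y \<bullet> d - y \<bullet> (transpose_mat G *\<^sub>v \<alpha>))"
    using assms x y \<alpha> by (simp add: scalar_prod_minus_distrib[of _ n1] scalar_prod_minus_distrib[of _ n2])
  also have "\<dots> = c \<bullet> x + d \<bullet> y - \<alpha> \<bullet> u"
    using assms x y \<alpha> transpose_vec_mult_scalar[of A m n1 x \<alpha>] transpose_vec_mult_scalar[of G m n2 y \<alpha>]
    by (simp add: u scalar_prod_add_distrib[of _ m] comm_scalar_prod[of x n1] comm_scalar_prod[of y n2])
  finally show ?thesis by simp
qed

lemma primal_value_eq_Inf:
  assumes "primal_feasible A G b M \<noteq> {}"
    and "\<And>x y. (x, y) \<in> primal_feasible A G b M \<Longrightarrow> l \<le> c \<bullet> x + d \<bullet> y"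
  shows "primal_value c d A G b M = ereal (INF (x, y)\<in>primal_feasible A G b M. c \<bullet> x + d \<bullet> y)"
proof -
  \<comment> \<open>Finiteness lets the extended infimum be exchanged for the real one:
    \<open>l\<close> excludes minus infinity, any feasible point excludes plus infinity.\<close>
  have "\<bar>INF (x, y)\<in>primal_feasible A G b M. ereal (c \<bullet> x + d \<bullet> y)\<bar> \<noteq> \<infinity>"
  proof -
    have "ereal l \<le> (INF (x, y)\<in>primal_feasible A G b M. ereal (c \<bullet> x + d \<bullet> y))"
      using assms(2) by (auto intro!: INF_greatest)
    moreover obtain x y where "(x, y) \<in> primal_feasible A G b M" using assms(1) by auto
    then have "(INF (x, y)\<in>primal_feasible A G b M. ereal (c \<bullet> x + d \<bullet> y)) \<le> ereal (c \<bullet> x + d \<bullet> y)"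
      by (intro INF_lower2[where i="(x, y)"]) auto
    ultimately show ?thesis by auto
  qed
  then show ?thesis
    unfolding primal_value_def by (subst ereal_INF) (auto simp: case_prod_unfold)
qed

section \<open>The truncated value function and its dual feasibility\<close>

definition truncated_value ::
  "real vec \<Rightarrow> real vec \<Rightarrow> real mat \<Rightarrow> real mat \<Rightarrow> real vec set \<Rightarrow> real vec \<Rightarrow> real \<Rightarrow> real vec \<Rightarrow> real"
  where "truncated_value c d A G M \<alpha> C u =
    Inf (insert (\<alpha> \<bullet> u + C) ((\<lambda>(x, y). c \<bullet> x + d \<bullet> y) ` primal_feasible A G u M))"

locale bounded_program =
  fixes n1 n2 m :: nat and K :: "real vec set" and c d :: "real vec" and A G :: "real mat"
    and \<alpha> :: "real vec" and C :: real
  assumes cone: "regular_cone (n1 + n2) K"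
    and c: "c \<in> carrier_vec n1" and d: "d \<in> carrier_vec n2"
    and A: "A \<in> carrier_mat m n1" and G: "G \<in> carrier_mat m n2"
    and dual: "\<alpha> \<in> conic_dual_feasible c d A G K"
    and C: "0 \<le> C"
begin

abbreviation "M \<equiv> mixed_integer_points n1 n2 K"
abbreviation "f \<equiv> truncated_value c d A G M \<alpha> C"

lemma \<alpha>: "\<alpha> \<in> carrier_vec m"
  using dual A by (auto simp: conic_dual_feasible_def)

lemma dual_bound: "(x, y) \<in> primal_feasible A G u M \<Longrightarrow> \<alpha> \<bullet> u \<le> c \<bullet> x + d \<bullet> y"
  by (rule conic_weak_duality[OF A G c d dual])
     (auto simp: primal_feasible_def mixed_integer_points_def)

text \<open>The inserted cap keeps the set nonempty even where the primal is infeasible, and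
  \<open>0 \<le> C\<close> puts the cap above the lower bound \<open>\<alpha> \<bullet> u\<close>.
  So the real \<open>Inf\<close> is a genuine infimum at every \<open>u\<close>.\<close>

lemma bdd: "bdd_below (insert (\<alpha> \<bullet> u + C) ((\<lambda>(x, y). c \<bullet> x + d \<bullet> y) ` primal_feasible A G u M))"
  by (rule bdd_belowI[where m="\<alpha> \<bullet> u"]) (use C dual_bound in auto)

lemma f_le_cap: "f u \<le> \<alpha> \<bullet> u + C"
  unfolding truncated_value_def by (rule cInf_lower[OF _ bdd]) simp

lemma f_le_cost: "(x, y) \<in> primal_feasible A G u M \<Longrightarrow> f u \<le> c \<bullet> x + d \<bullet> y"
  unfolding truncated_value_def by (rule cInf_lower[OF _ bdd]) force

lemma f_greatest:
  assumes "l \<le> \<alpha> \<bullet> u + C" "\<And>x y. (x, y) \<in> primal_feasible A G u M \<Longrightarrow> l \<le> c \<bullet> x + d \<bullet> y"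
  shows "l \<le> f u"
  unfolding truncated_value_def by (rule cInf_greatest) (use assms in auto)

lemma f_zero:
  assumes "K \<noteq> {}"
  shows "f (0\<^sub>v m) = 0"
proof (rule antisym)
  have "(0\<^sub>v n1, 0\<^sub>v n2) \<in> primal_feasible A G (0\<^sub>v m) M"
    using A G mixed_integer_points_zero[OF cone assms]
    by (auto simp: primal_feasible_def mult_mat_vec_zero[of A m n1] mult_mat_vec_zero[of G m n2])
  from f_le_cost[OF this] show "f (0\<^sub>v m) \<le> 0" using c d by simp
  show "0 \<le> f (0\<^sub>v m)"
    using f_greatest[of 0 "0\<^sub>v m"] dual_bound[of _ _ "0\<^sub>v m"] C \<alpha> by simp
qed

text \<open>The infima need not be attained, so \<open>f_greatest\<close> is applied to
  \<open>u\<close> and then to \<open>v\<close>. Two feasible points add up to a feasible point for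
  \<open>u + v\<close>; if one argument is at its cap, the cap of \<open>u + v\<close> suffices, as
  the other contributes at least its linear part.\<close>

lemma f_subadditive: "subadditive_on (carrier_vec m) f"
  unfolding subadditive_on_def
proof (intro ballI impI)
  fix u v :: "real vec" assume u: "u \<in> carrier_vec m" and v: "v \<in> carrier_vec m"
  have dist: "\<alpha> \<bullet> (u + v) = \<alpha> \<bullet> u + \<alpha> \<bullet> v"
    using \<alpha> u v by (rule scalar_prod_add_distrib)
  have cap: "f (u + v) \<le> \<alpha> \<bullet> u + \<alpha> \<bullet> v + C" using f_le_cap[of "u + v"] dist by simp
  have fv: "\<alpha> \<bullet> v \<le> f v" using f_greatest[of "\<alpha> \<bullet> v" v] dual_bound[of _ _ v] C by simp
  have "f (u + v) - f v \<le> f u"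
  proof (rule f_greatest)
    show "f (u + v) - f v \<le> \<alpha> \<bullet> u + C" using cap fv by simp
  next
    fix x y assume xy: "(x, y) \<in> primal_feasible A G u M"
    \<comment> \<open>With the point for \<open>u\<close> fixed, the roles are exchanged and
      \<open>f v\<close> becomes the infimum to bound from below.\<close>
    have "f (u + v) - (c \<bullet> x + d \<bullet> y) \<le> f v"
    proof (rule f_greatest)
      show "f (u + v) - (c \<bullet> x + d \<bullet> y) \<le> \<alpha> \<bullet> v + C" using cap dual_bound[OF xy] by simp
    next
      fix x' y' assume xy': "(x', y') \<in> primal_feasible A G v M"
      have "f (u + v) \<le> c \<bullet> (x + x') + d \<bullet> (y + y')"
        by (rule f_le_cost[OF primal_feasible_add[OF cone A G xy xy']])
      also have "\<dots> = (c \<bullet> x + d \<bullet> y) + (c \<bullet> x' + d \<bullet> y')"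
        using xy xy' A G by (intro scalar_prod_add_swap[OF c d]) (auto simp: primal_feasible_def)
      finally show "f (u + v) - (c \<bullet> x + d \<bullet> y) \<le> c \<bullet> x' + d \<bullet> y'" by simp
    qed
    then show "f (u + v) - f v \<le> c \<bullet> x + d \<bullet> y" by simp
  qed
  then show "f (u + v) \<le> f u + f v" by simp
qed

text \<open>A generator is itself a feasible point for the right-hand side it produces, so its cost
  bounds \<open>f\<close> there.\<close>

lemma f_dual_feasible:
  assumes "K \<noteq> {}" "H \<subseteq> M"
  shows "f \<in> subadditive_dual_feasible c d A G H"
  unfolding subadditive_dual_feasible_def
  using A G f_zero[OF assms(1)] f_subadditive assms(2)
  by (auto simp: primal_feasible_def intro!: f_le_cost)

end

section \<open>Weak duality for the subadditive dual\<close>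

lemma subadditive_weak_duality:
  assumes c: "c \<in> carrier_vec n1" and d: "d \<in> carrier_vec n2"
    and A: "A \<in> carrier_mat m n1" and G: "G \<in> carrier_mat m n2"
    and M: "M \<subseteq> carrier_vec (n1 + n2)"
    and gen: "integral_generating_set (n1 + n2) M H"
    and g: "g \<in> subadditive_dual_feasible c d A G H"
    and xy: "(x, y) \<in> primal_feasible A G b M"
  shows "g b \<le> c \<bullet> x + d \<bullet> y"
proof -
  \<comment> \<open>The dual constraint as a property of one concatenated vector, in the form that
    \<open>nat_combination_closed\<close> needs to carry it from \<open>H\<close> to all of
    \<open>M\<close>. The fixed dimensions make the splitting of \<open>w\<close> unique.\<close>
  define P where "P w \<longleftrightarrow> (\<forall>x\<in>carrier_vec n1. \<forall>y\<in>carrier_vec n2. w = x @\<^sub>v y \<longrightarrow>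
    g (A *\<^sub>v x + G *\<^sub>v y) \<le> c \<bullet> x + d \<bullet> y)" for w
  have sub: "g (u + v) \<le> g u + g v" if "u \<in> carrier_vec m" "v \<in> carrier_vec m" for u v
    using g A that by (auto simp: subadditive_dual_feasible_def subadditive_on_def)
  have P0: "P (0\<^sub>v (n1 + n2))"
    unfolding P_def
  proof (intro ballI impI)
    fix x y :: "real vec"
    assume x: "x \<in> carrier_vec n1" and y: "y \<in> carrier_vec n2" and eq: "0\<^sub>v (n1 + n2) = x @\<^sub>v y"
    have "0\<^sub>v n1 @\<^sub>v 0\<^sub>v n2 = x @\<^sub>v y" unfolding eq[symmetric] by (intro eq_vecI) auto
    then have "x = 0\<^sub>v n1" "y = 0\<^sub>v n2"
      using x append_vec_eq[of "0\<^sub>v n1" n1 x "0\<^sub>v n2" y] by auto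
    then show "g (A *\<^sub>v x + G *\<^sub>v y) \<le> c \<bullet> x + d \<bullet> y"
      using c d A G g
      by (auto simp: subadditive_dual_feasible_def mult_mat_vec_zero[of A m n1] mult_mat_vec_zero[of G m n2])
  qed
  have Padd: "P (v + w)"
    if v: "v \<in> carrier_vec (n1 + n2)" "P v" and w: "w \<in> carrier_vec (n1 + n2)" "P w" for v w
    unfolding P_def
  proof (intro ballI impI)
    fix x y :: "real vec"
    assume x: "x \<in> carrier_vec n1" and y: "y \<in> carrier_vec n2" and eq: "v + w = x @\<^sub>v y"
    obtain v1 v2 where v12: "v1 \<in> carrier_vec n1" "v2 \<in> carrier_vec n2" "v = v1 @\<^sub>v v2"
      using vec_first_last_append[OF v(1)] by (metis vec_first_carrier vec_last_carrier)
    obtain w1 w2 where w12: "w1 \<in> carrier_vec n1" "w2 \<in> carrier_vec n2" "w = w1 @\<^sub>v w2"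
      using vec_first_last_append[OF w(1)] by (metis vec_first_carrier vec_last_carrier)
    have "(v1 + w1) @\<^sub>v (v2 + w2) = x @\<^sub>v y"
      using eq v12 w12 by (simp add: append_vec_add)
    then have xy: "x = v1 + w1" "y = v2 + w2"
      using x v12 w12 append_vec_eq[of "v1 + w1" n1 x "v2 + w2" y] by auto
    have "g (A *\<^sub>v x + G *\<^sub>v y) \<le> g (A *\<^sub>v v1 + G *\<^sub>v v2) + g (A *\<^sub>v w1 + G *\<^sub>v w2)"
      unfolding xy using A G v12 w12 by (subst mult_mat_vec_add_swap[OF A G]) (auto intro!: sub)
    also have "\<dots> \<le> (c \<bullet> v1 + d \<bullet> v2) + (c \<bullet> w1 + d \<bullet> w2)"
      using v(2) w(2) v12 w12 unfolding P_def by (intro add_mono) auto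
    also have "\<dots> = c \<bullet> x + d \<bullet> y"
      unfolding xy using v12 w12 by (intro scalar_prod_add_swap[OF c d, symmetric]) auto
    finally show "g (A *\<^sub>v x + G *\<^sub>v y) \<le> c \<bullet> x + d \<bullet> y" .
  qed
  have PH: "P h" if "h \<in> H" for h
    using g A G that by (auto simp: P_def subadditive_dual_feasible_def)
  have HM: "H \<subseteq> carrier_vec (n1 + n2)"
    using gen M by (auto simp: integral_generating_set_def)
  have "x @\<^sub>v y \<in> M" using xy by (auto simp: primal_feasible_def)
  then obtain p :: nat and l :: "nat \<Rightarrow> nat" and h where h: "\<forall>i<p. h i \<in> H"
    and eq: "x @\<^sub>v y = finsum_vec TYPE(real) (n1 + n2) (\<lambda>i. real (l i) \<cdot>\<^sub>v h i) {..<p}"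
    using gen unfolding integral_generating_set_def by blast
  have "P (x @\<^sub>v y)"
    unfolding eq by (rule nat_combination_closed[of P]) (use P0 Padd h HM PH in auto)
  then show ?thesis using xy A G by (auto simp: P_def primal_feasible_def)
qed

section \<open>Strong duality, with the dual optimum attained\<close>

theorem proposition6:
  fixes n1 n2 m :: nat
    and K H :: "real vec set"
    and c d b :: "real vec"
    and A G :: "real mat"
  defines "M \<equiv> mixed_integer_points n1 n2 K"
  assumes "regular_cone (n1 + n2) K"
    and "c \<in> carrier_vec n1" and "d \<in> carrier_vec n2"
    and "A \<in> carrier_mat m n1" and "G \<in> carrier_mat m n2"
    and "b \<in> carrier_vec m"
    and "integral_generating_set (n1 + n2) M H"
    and "primal_feasible A G b M \<noteq> {}"
    and "conic_dual_feasible c d A G K \<noteq> {}"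
  shows "\<exists>f \<in> subadditive_dual_feasible c d A G H.
           ereal (f b) = subadditive_dual_value c d A G b H \<and>
           subadditive_dual_value c d A G b H = primal_value c d A G b M"
proof -
  obtain \<alpha> where \<alpha>: "\<alpha> \<in> conic_dual_feasible c d A G K" using assms(10) by blast
  define z where "z = (INF (x, y)\<in>primal_feasible A G b M. c \<bullet> x + d \<bullet> y)"
  have MK: "M \<subseteq> K" by (auto simp: M_def mixed_integer_points_def)
  have bound: "\<alpha> \<bullet> b \<le> c \<bullet> x + d \<bullet> y" if "(x, y) \<in> primal_feasible A G b M" for x y
    by (rule conic_weak_duality[OF assms(5,6,3,4) \<alpha>]) (use that MK in \<open>auto simp: primal_feasible_def\<close>)
  have z: "primal_value c d A G b M = ereal z"
    unfolding z_def by (rule primal_value_eq_Inf[OF assms(9) bound])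
  \<comment> \<open>This is \<open>0 \<le> C\<close> for the cap constant
    \<open>C = z - \<alpha> \<bullet> b\<close> of the interpretation below.\<close>
  have "\<alpha> \<bullet> b \<le> z"
    unfolding z_def using assms(9) bound by (intro cINF_greatest) auto
  then interpret bounded_program n1 n2 m K c d A G \<alpha> "z - \<alpha> \<bullet> b"
    using assms \<alpha> by unfold_locales auto
  let ?f = "truncated_value c d A G M \<alpha> (z - \<alpha> \<bullet> b)"
  have "K \<noteq> {}" using assms(9) MK by (auto simp: primal_feasible_def)
  then have feas: "?f \<in> subadditive_dual_feasible c d A G H"
    unfolding M_def
    by (rule f_dual_feasible) (use assms(8) in \<open>auto simp: integral_generating_set_def M_def\<close>)
  \<comment> \<open>At \<open>b\<close> the cap equals \<open>z\<close>, and every feasible cost is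
    at least \<open>z\<close>. The reverse inequality will come from weak duality.\<close>
  have "z \<le> ?f b"
    unfolding M_def
  proof (rule f_greatest)
    fix x y assume "(x, y) \<in> primal_feasible A G b (mixed_integer_points n1 n2 K)"
    then show "z \<le> c \<bullet> x + d \<bullet> y"
      unfolding z_def M_def[symmetric]
      by (intro cINF_lower2[where x="(x, y)"] bdd_belowI2[where m="\<alpha> \<bullet> b"]) (use bound in auto)
  qed simp
  then have fb: "ereal z \<le> ereal (?f b)" by simp
  have weak: "subadditive_dual_value c d A G b H \<le> primal_value c d A G b M"
    unfolding subadditive_dual_value_def primal_value_def
    using subadditive_weak_duality[OF assms(3-6) _ assms(8)] MK assms(2)
    by (intro SUP_least INF_greatest) (auto simp: regular_cone_def)
  have "ereal (?f b) \<le> subadditive_dual_value c d A G b H"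
    unfolding subadditive_dual_value_def using feas by (rule SUP_upper)
  \<comment> \<open>The chain from \<open>z\<close> through \<open>?f b\<close> and the dual value
    to the primal value returns to \<open>z\<close>, so all its inequalities are equalities.\<close>
  with fb weak z have "ereal (?f b) = subadditive_dual_value c d A G b H"
    and "subadditive_dual_value c d A G b H = primal_value c d A G b M"
    by (metis order.trans order.antisym)+
  with feas show ?thesis by blast
qed

end
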